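(* A helicoidal surface $\Psi(u,t)=\psi_{[U,m,a]}(u,t)$ in the BCV-space $\mathcal N_{\kappa,\tau}$ (determined by the positive function $U(u)$ and the constants $m\neq0$, $a$ as in the context) has constant mean curvature $H$ if and only if $U(u)$ satisfies the differential equation $$H\sqrt{\frac{4(m^2U^2-a^2)}{(1+\sqrt\Delta)^2-4\tau^2m^2U^2}-\frac{m^4B^2U^2U'^2}{\Delta}}=2-B-m^2B\left(\frac{UU'}{\sqrt\Delta}\right)',$$ where $$\Delta=(1-2a\tau)^2+(m^2U^2-a^2)(4\tau^2-\kappa)\quad\text{and}\quad B=2\,\frac{1-2a\tau+\sqrt\Delta}{(1+\sqrt\Delta)^2-4\tau^2m^2U^2}.$$
   Context: For $\kappa,\tau\in\mathbb R$, the Bianchi-Cartan-Vranceanu (BCV) space $\mathcal N_{\kappa,\tau}$ is the open subset of $\mathbb R^3$ where $B_0=1+\frac{\kappa}{4}(x^2+y^2)>0$, with the metric $g_{\kappa,\tau}=\frac{dx^2+dy^2}{B_0^2}+\big(dz+\tau\frac{y\,dx-x\,dy}{B_0}\big)^2$. Cylindrical coordinates $(r,\theta,z)$ with $x=r\cos\theta$, $y=r\sin\theta$ are used. Given a function $U(u)>0$ and constants $m\ne0$, $a$, with $\Delta$ as in the claim put $$\xi_1=2\sqrt{\frac{m^2U^2-a^2}{(1+\sqrt\Delta)^2-4\tau^2m^2U^2}},\qquad \xi_2=\int\frac{mU(4+\kappa\xi_1^2)}{4\xi_1^2}\sqrt{\xi_1^2-\frac{m^4U^2U'^2(4+\kappa\xi_1^2)^2}{16\Delta}}\,du,$$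 $$\theta(u,t)=\frac tm+\int\frac{(4\tau-a\kappa)\xi_1^2-4a}{4mU\xi_1^2}\sqrt{\xi_1^2-\frac{m^4U^2U'^2(4+\kappa\xi_1^2)^2}{16\Delta}}\,du .$$ Then $\psi_{[U,m,a]}(u,t)=(\xi_1(u),\theta(u,t),\xi_2(u)+a\theta(u,t))$ in cylindrical coordinates is a helicoidal surface (invariant under the isometries generated by $\partial_\theta+a\,\partial_z$) with first fundamental form $du^2+U^2dt^2$. The function $B$ in the claim equals $1+\frac\kappa4\xi_1^2$. Mean curvature is the trace of the second fundamental form (not divided by 2). In terms of the profile curve, with $\xi_1'=B\cos\sigma$ and $\xi_2'=\frac{\sqrt{\xi_1^2+(aB-\tau\xi_1^2)^2}}{\xi_1}\sin\sigma$, it is $H=\sigma'+\big(\frac1{\xi_1}-\frac\kappa4\xi_1\big)\sin\sigma$.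
   Formalization: The expression under the square root is assumed strictly positive (where it vanishes identically, e.g. a plane or helicoid, the equation holds for every H though the surface is minimal); the normal is the one making (Ψ_u, Ψ_t, N) positively oriented, which fixes the sign of H also for m<0. *)

theory Defs
  imports "HOL-Analysis.Analysis"
begin

section \<open>Surfaces in an open part of \<open>\<real>\<^sup>3\<close> with a Riemannian metric\<close>

text \<open>A metric is given by its values \<open>g p v w\<close> on pairs of tangent vectors \<open>v\<close>, \<open>w\<close> at \<open>p\<close>.\<close>

type_synonym metric3 = "real^3 \<Rightarrow> real^3 \<Rightarrow> real^3 \<Rightarrow> real"

definition gram :: "metric3 \<Rightarrow> real^3 \<Rightarrow> real^3^3" where
  "gram g p = (\<chi> i j. g p (axis i 1) (axis j 1))"

definition metric_partial :: "metric3 \<Rightarrow> real^3 \<Rightarrow> 3 \<Rightarrow> 3 \<Rightarrow> 3 \<Rightarrow> real" where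
  "metric_partial g p i j l = deriv (\<lambda>s. gram g (p + s *\<^sub>R axis i 1) $ j $ l) 0"

text \<open>\<open>christoffel g p k i j\<close> is the Levi-Civita symbol with upper index \<open>k\<close> and lower
  indices \<open>i\<close>, \<open>j\<close>.\<close>

definition christoffel :: "metric3 \<Rightarrow> real^3 \<Rightarrow> 3 \<Rightarrow> 3 \<Rightarrow> 3 \<Rightarrow> real" where
  "christoffel g p k i j =
     (1/2) * (\<Sum>l\<in>UNIV. matrix_inv (gram g p) $ k $ l *
        (metric_partial g p i j l + metric_partial g p j i l - metric_partial g p l i j))"

text \<open>Covariant derivative, along a curve through \<open>p\<close> with velocity \<open>X\<close>, of a vector field
  along that curve with value \<open>Y\<close> and componentwise derivative \<open>dY\<close> at \<open>p\<close>.\<close>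

definition cov_deriv :: "metric3 \<Rightarrow> real^3 \<Rightarrow> real^3 \<Rightarrow> real^3 \<Rightarrow> real^3 \<Rightarrow> real^3" where
  "cov_deriv g p X Y dY =
     (\<chi> k. dY $ k + (\<Sum>i\<in>UNIV. \<Sum>j\<in>UNIV. christoffel g p k i j * X $ i * Y $ j))"

definition unit_normal :: "metric3 \<Rightarrow> real^3 \<Rightarrow> real^3 \<Rightarrow> real^3 \<Rightarrow> real^3" where
  "unit_normal g p X Y =
     (THE N. g p N X = 0 \<and> g p N Y = 0 \<and> g p N N = 1 \<and> det (vector [X, Y, N] :: real^3^3) > 0)"

definition partial_u :: "(real \<Rightarrow> real \<Rightarrow> real^3) \<Rightarrow> real \<Rightarrow> real \<Rightarrow> real^3" where
  "partial_u \<psi> u t = vector_derivative (\<lambda>s. \<psi> s t) (at u)"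

definition partial_t :: "(real \<Rightarrow> real \<Rightarrow> real^3) \<Rightarrow> real \<Rightarrow> real \<Rightarrow> real^3" where
  "partial_t \<psi> u t = vector_derivative (\<lambda>s. \<psi> u s) (at t)"

text \<open>The trace, not halved, of the second fundamental form
  \<open>II(X,Y) = g(\<nabla>\<^sub>X Y, N)\<close> with respect to the first fundamental form
  \<open>E du\<^sup>2 + 2 F du dt + G dt\<^sup>2\<close>, for the unit normal \<open>N\<close> such that
  \<open>(\<psi>\<^sub>u, \<psi>\<^sub>t, N)\<close> is positively oriented.\<close>

definition mean_curvature ::
    "metric3 \<Rightarrow> (real \<Rightarrow> real \<Rightarrow> real^3) \<Rightarrow> real \<Rightarrow> real \<Rightarrow> real" where
  "mean_curvature g \<psi> u t =
    (let p = \<psi> u t; X = partial_u \<psi> u t; Y = partial_t \<psi> u t;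
         N = unit_normal g p X Y;
         E = g p X X; F = g p X Y; G = g p Y Y;
         L = g p (cov_deriv g p X X (partial_u (partial_u \<psi>) u t)) N;
         M = g p (cov_deriv g p X Y (partial_u (partial_t \<psi>) u t)) N;
         K = g p (cov_deriv g p Y Y (partial_t (partial_t \<psi>) u t)) N
     in (E * K - 2 * F * M + G * L) / (E * G - F\<^sup>2))"

section \<open>Bianchi-Cartan-Vranceanu spaces\<close>

definition bcv_factor :: "real \<Rightarrow> real^3 \<Rightarrow> real" where
  "bcv_factor \<kappa> p = 1 + \<kappa> / 4 * ((p$1)\<^sup>2 + (p$2)\<^sup>2)"

definition bcv_space :: "real \<Rightarrow> (real^3) set" where
  "bcv_space \<kappa> = {p. bcv_factor \<kappa> p > 0}"

definition bcv_form :: "real \<Rightarrow> real \<Rightarrow> real^3 \<Rightarrow> real^3 \<Rightarrow> real" where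
  "bcv_form \<kappa> \<tau> p v = v$3 + \<tau> * (p$2 * v$1 - p$1 * v$2) / bcv_factor \<kappa> p"

definition bcv_metric :: "real \<Rightarrow> real \<Rightarrow> metric3" where
  "bcv_metric \<kappa> \<tau> p v w =
     (v$1 * w$1 + v$2 * w$2) / (bcv_factor \<kappa> p)\<^sup>2 + bcv_form \<kappa> \<tau> p v * bcv_form \<kappa> \<tau> p w"

definition cylindrical :: "real \<Rightarrow> real \<Rightarrow> real \<Rightarrow> real^3" where
  "cylindrical r \<theta> z = vector [r * cos \<theta>, r * sin \<theta>, z]"

section \<open>The helicoidal surfaces determined by \<open>U\<close>, \<open>m\<close>, \<open>a\<close>\<close>

definition hel_Delta :: "real \<Rightarrow> real \<Rightarrow> (real \<Rightarrow> real) \<Rightarrow> real \<Rightarrow> real \<Rightarrow> real \<Rightarrow> real" where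
  "hel_Delta \<kappa> \<tau> U m a u = (1 - 2*a*\<tau>)\<^sup>2 + (m\<^sup>2 * (U u)\<^sup>2 - a\<^sup>2) * (4*\<tau>\<^sup>2 - \<kappa>)"

definition hel_denom :: "real \<Rightarrow> real \<Rightarrow> (real \<Rightarrow> real) \<Rightarrow> real \<Rightarrow> real \<Rightarrow> real \<Rightarrow> real" where
  "hel_denom \<kappa> \<tau> U m a u =
     (1 + sqrt (hel_Delta \<kappa> \<tau> U m a u))\<^sup>2 - 4 * \<tau>\<^sup>2 * m\<^sup>2 * (U u)\<^sup>2"

definition hel_xi1 :: "real \<Rightarrow> real \<Rightarrow> (real \<Rightarrow> real) \<Rightarrow> real \<Rightarrow> real \<Rightarrow> real \<Rightarrow> real" where
  "hel_xi1 \<kappa> \<tau> U m a u = 2 * sqrt ((m\<^sup>2 * (U u)\<^sup>2 - a\<^sup>2) / hel_denom \<kappa> \<tau> U m a u)"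

definition hel_B :: "real \<Rightarrow> real \<Rightarrow> (real \<Rightarrow> real) \<Rightarrow> real \<Rightarrow> real \<Rightarrow> real \<Rightarrow> real" where
  "hel_B \<kappa> \<tau> U m a u =
     2 * (1 - 2*a*\<tau> + sqrt (hel_Delta \<kappa> \<tau> U m a u)) / hel_denom \<kappa> \<tau> U m a u"

definition hel_radicand :: "real \<Rightarrow> real \<Rightarrow> (real \<Rightarrow> real) \<Rightarrow> real \<Rightarrow> real \<Rightarrow> real \<Rightarrow> real" where
  "hel_radicand \<kappa> \<tau> U m a u =
     (hel_xi1 \<kappa> \<tau> U m a u)\<^sup>2
     - m^4 * (U u)\<^sup>2 * (deriv U u)\<^sup>2 * (4 + \<kappa> * (hel_xi1 \<kappa> \<tau> U m a u)\<^sup>2)\<^sup>2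
       / (16 * hel_Delta \<kappa> \<tau> U m a u)"

definition hel_xi2_integrand ::
    "real \<Rightarrow> real \<Rightarrow> (real \<Rightarrow> real) \<Rightarrow> real \<Rightarrow> real \<Rightarrow> real \<Rightarrow> real" where
  "hel_xi2_integrand \<kappa> \<tau> U m a u =
     m * U u * (4 + \<kappa> * (hel_xi1 \<kappa> \<tau> U m a u)\<^sup>2) / (4 * (hel_xi1 \<kappa> \<tau> U m a u)\<^sup>2)
     * sqrt (hel_radicand \<kappa> \<tau> U m a u)"

definition hel_theta_integrand ::
    "real \<Rightarrow> real \<Rightarrow> (real \<Rightarrow> real) \<Rightarrow> real \<Rightarrow> real \<Rightarrow> real \<Rightarrow> real" where
  "hel_theta_integrand \<kappa> \<tau> U m a u =
     ((4*\<tau> - a*\<kappa>) * (hel_xi1 \<kappa> \<tau> U m a u)\<^sup>2 - 4*a) / (4 * m * U u * (hel_xi1 \<kappa> \<tau> U m a u)\<^sup>2)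
     * sqrt (hel_radicand \<kappa> \<tau> U m a u)"

definition primitive_on :: "real set \<Rightarrow> (real \<Rightarrow> real) \<Rightarrow> (real \<Rightarrow> real) \<Rightarrow> bool" where
  "primitive_on I f F \<longleftrightarrow> (\<forall>u\<in>I. (F has_real_derivative f u) (at u))"

text \<open>The surface in Cartesian coordinates. The arguments \<open>\<xi>\<^sub>2\<close> and \<open>\<Theta>\<close> stand for choices of
  the two indefinite integrals, that is, primitives of \<open>hel_xi2_integrand\<close> and \<open>hel_theta_integrand\<close>.\<close>

definition helicoidal_surface ::
    "real \<Rightarrow> real \<Rightarrow> (real \<Rightarrow> real) \<Rightarrow> real \<Rightarrow> real \<Rightarrow> (real \<Rightarrow> real) \<Rightarrow> (real \<Rightarrow> real)
       \<Rightarrow> real \<Rightarrow> real \<Rightarrow> real^3" where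
  "helicoidal_surface \<kappa> \<tau> U m a \<xi>\<^sub>2 \<Theta> u t =
     (let \<theta> = t / m + \<Theta> u in cylindrical (hel_xi1 \<kappa> \<tau> U m a u) \<theta> (\<xi>\<^sub>2 u + a * \<theta>))"

end

theory Submission
  imports Defs
begin

text \<open>
  In the orthonormal frame \<open>e\<^sub>1 = B \<partial>\<^sub>r\<close>, \<open>e\<^sub>2 = (B/r) \<partial>\<^sub>\<theta> + \<tau> r \<partial>\<^sub>z\<close>, \<open>e\<^sub>3 = \<partial>\<^sub>z\<close>
  with \<open>B = 1 + \<kappa> r\<^sup>2/4\<close> and \<open>r = \<xi>\<^sub>1\<close>, the surface has \<open>\<psi>\<^sub>u = (k, - c w, b w)\<close>,
  \<open>\<psi>\<^sub>t = U (0, b, c)\<close> and \<open>N = (- w, - k c, k b)\<close>, where \<open>(b, c)\<close> and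
  \<open>(k, w) = (cos \<sigma>, sin \<sigma>)\<close> are unit vectors. Hence the first fundamental form is
  \<open>du\<^sup>2 + U\<^sup>2 dt\<^sup>2\<close>, and the connection terms in \<open>b\<close>, \<open>c\<close> cancel in the trace, leaving
  \<open>H = (2 - B) w / r - k' / w\<close>. Since \<open>k = P B / r\<close> with \<open>P = m\<^sup>2 U U' / \<surd>\<Delta>\<close>, and
  \<open>r w\<close> is the square root on the left of the differential equation, multiplying by \<open>r w\<close> gives
  \<open>H r w = 2 - B - B P'\<close>.
\<close>

section \<open>Derivatives\<close>

lemma has_vector_derivative_vector_3:
  fixes f g h :: "real \<Rightarrow> real"
  assumes "(f has_real_derivative f') F" "(g has_real_derivative g') F" "(h has_real_derivative h') F"
  shows "((\<lambda>s. vector [f s, g s, h s] :: real^3) has_vector_derivative vector [f', g', h']) F"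
proof -
  have V: "(vector [x, y, z] :: real^3) = x *\<^sub>R axis 1 1 + y *\<^sub>R axis 2 1 + z *\<^sub>R axis 3 1"
    for x y z :: real
    by (simp add: vec_eq_iff forall_3 axis_def)
  show ?thesis
    unfolding V using assms
    by (intro has_vector_derivative_add bounded_linear.has_vector_derivative[OF bounded_linear_scaleR_left])
      (simp_all add: has_real_derivative_iff_has_vector_derivative)
qed

lemma DERIV_sqrt_comp:
  fixes f :: "real \<Rightarrow> real"
  assumes "(f has_real_derivative f') (at u)" "f u > 0"
  shows "((\<lambda>v. sqrt (f v)) has_real_derivative f' / (2 * sqrt (f u))) (at u)"
  by (rule DERIV_cong[OF DERIV_chain2[where f = sqrt, OF DERIV_real_sqrt[OF assms(2)] assms(1)]])
    (simp add: field_simps)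

lemma DERIV_sum_squares_eq_1:
  fixes f g :: "real \<Rightarrow> real"
  assumes "open I" "u \<in> I" "\<And>v. v \<in> I \<Longrightarrow> (f v)\<^sup>2 + (g v)\<^sup>2 = 1"
    and "(f has_real_derivative f') (at u)" "(g has_real_derivative g') (at u)"
  shows "f u * f' + g u * g' = 0"
proof -
  have "((\<lambda>v. (f v)\<^sup>2 + (g v)\<^sup>2) has_real_derivative 2 * (f u * f' + g u * g')) (at u)"
    using assms(4,5) by (auto intro!: derivative_eq_intros)
  moreover have "((\<lambda>v. (f v)\<^sup>2 + (g v)\<^sup>2) has_real_derivative 0) (at u)"
    by (rule has_field_derivative_transform_within_open[OF DERIV_const assms(1,2)]) (use assms(3) in simp)
  ultimately show ?thesis
    using DERIV_unique by fastforce
qed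

section \<open>Unit normal and covariant derivative of a metric given by its Gram matrix\<close>

lemma matrix_inv_right_inverse:
  fixes A :: "real^'n^'n"
  assumes "invertible A"
  shows "A ** matrix_inv A = mat 1"
  using assms unfolding invertible_def matrix_inv_def by (metis (mono_tags, lifting) someI_ex)

text \<open>The three equations say that the matrix with rows \<open>X\<close>, \<open>Y\<close>,
  \<open>N\<close> annihilates \<open>gram g p *v D\<close>. That matrix and the Gram matrix both
  have trivial kernel.\<close>

lemma gram_nondegenerate_eq_zero:
  fixes g :: metric3
  assumes gram: "\<And>v w. g p v w = v \<bullet> (gram g p *v w)"
    and inv: "invertible (gram g p)"
    and det: "det (vector [X, Y, N] :: real^3^3) \<noteq> 0"
    and orth: "g p X D = 0" "g p Y D = 0" "g p N D = 0"
  shows "D = 0"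
proof -
  have "(vector [X, Y, N] :: real^3^3) *v (gram g p *v D) = 0"
    using orth unfolding gram matrix_vector_mul_component
    by (simp add: vec_eq_iff forall_3 matrix_vector_mul_component inner_commute)
  then have "gram g p *v D = 0"
    using det by (metis invertible_det_nz matrix_left_invertible_ker invertible_left_inverse)
  then show ?thesis
    using inv by (metis matrix_left_invertible_ker invertible_left_inverse)
qed

text \<open>Uniqueness is the point. If \<open>M\<close> is another candidate and
  \<open>c = g p N M\<close>, then \<open>M - c *\<^sub>R N\<close> is orthogonal to the basis
  \<open>X\<close>, \<open>Y\<close>, \<open>N\<close>, hence zero. Unit length gives
  \<open>c * c = 1\<close>, and the orientation selects \<open>c = 1\<close>.\<close>

lemma unit_normal_eqI:
  fixes g :: metric3
  assumes gram: "\<And>v w. g p v w = v \<bullet> (gram g p *v w)"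
    and sym: "\<And>v w. g p v w = g p w v"
    and inv: "invertible (gram g p)"
    and N: "g p N X = 0" "g p N Y = 0" "g p N N = 1" "det (vector [X, Y, N] :: real^3^3) > 0"
  shows "unit_normal g p X Y = N"
  unfolding unit_normal_def
proof (rule the_equality)
  show "g p N X = 0 \<and> g p N Y = 0 \<and> g p N N = 1 \<and> det (vector [X, Y, N] :: real^3^3) > 0"
    using N by blast
next
  fix M
  assume M: "g p M X = 0 \<and> g p M Y = 0 \<and> g p M M = 1 \<and> det (vector [X, Y, M] :: real^3^3) > 0"
  define c where "c = g p N M"
  have lin: "g p V (M - c *\<^sub>R N) = g p V M - c * g p V N" for V
    unfolding gram by (simp add: matrix_vector_mult_diff_distrib inner_diff_right
        matrix_vector_mult_scaleR)
  have "g p X (M - c *\<^sub>R N) = 0" "g p Y (M - c *\<^sub>R N) = 0" "g p N (M - c *\<^sub>R N) = 0"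
    using N M unfolding lin by (simp_all add: c_def sym[of X] sym[of Y])
  then have "M - c *\<^sub>R N = 0"
    by (rule gram_nondegenerate_eq_zero[OF gram inv less_imp_neq[OF N(4), symmetric]])
  then have Mc: "M = c *\<^sub>R N" by simp
  have "g p (c *\<^sub>R N) (c *\<^sub>R N) = c * (c * g p N N)"
    unfolding gram by (simp add: matrix_vector_mult_scaleR)
  then have "c * c = 1" using M N(3) Mc by simp
  moreover have "det (vector [X, Y, M] :: real^3^3) = c * det (vector [X, Y, N] :: real^3^3)"
    unfolding Mc det_3 by (simp add: algebra_simps)
  then have "c > 0" using M N(4) by (metis zero_less_mult_pos2)
  ultimately have "c = 1" by (auto simp: square_eq_1_iff)
  then show "M = N" using Mc by simp
qed

text \<open>The Koszul formula in coordinates, where \<open>D Z V W\<close> differentiates the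
  metric coefficients along \<open>Z\<close> with the components of \<open>V\<close> and
  \<open>W\<close> held constant. Pairing with \<open>N\<close> cancels the inverse Gram matrix
  inside the Christoffel symbols, so that inverse never has to be computed.\<close>

lemma metric_cov_deriv:
  fixes g :: metric3
  assumes gram: "\<And>v w. g p v w = v \<bullet> (gram g p *v w)"
    and sym: "\<And>v w. g p v w = g p w v"
    and inv: "invertible (gram g p)"
    and D: "\<And>Z V W. D Z V W =
      (\<Sum>i\<in>UNIV. \<Sum>j\<in>UNIV. \<Sum>l\<in>UNIV. metric_partial g p i j l * Z $ i * V $ j * W $ l)"
  shows "g p (cov_deriv g p X Y dY) N = g p dY N + (D X Y N + D Y X N - D N X Y) / 2"
proof -
  define C :: "real^3" where "C = (\<chi> k. \<Sum>i\<in>UNIV. \<Sum>j\<in>UNIV. christoffel g p k i j * X $ i * Y $ j)"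
  \<comment> \<open>Christoffel symbols of the first kind contracted with \<open>X\<close> and
    \<open>Y\<close>; raising the index of \<open>L\<close> gives \<open>C\<close>.\<close>
  define L :: "real^3" where "L = (\<chi> l. (\<Sum>i\<in>UNIV. \<Sum>j\<in>UNIV. (metric_partial g p i j l
      + metric_partial g p j i l - metric_partial g p l i j) * X $ i * Y $ j) / 2)"
  have "cov_deriv g p X Y dY = dY + C"
    by (simp add: cov_deriv_def C_def vec_eq_iff)
  have "C = matrix_inv (gram g p) *v L"
    by (simp add: C_def L_def vec_eq_iff christoffel_def matrix_vector_mult_def sum_3 algebra_simps
       add_divide_distrib diff_divide_distrib)
  then have "gram g p *v C = L"
    using matrix_inv_right_inverse[OF inv] by (simp add: matrix_vector_mul_assoc)
  then have "g p N C = N \<bullet> L" by (simp add: gram)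
  also have "\<dots> = (D X Y N + D Y X N - D N X Y) / 2"
    unfolding D by (simp add: L_def inner_vec_def sum_3 algebra_simps
       add_divide_distrib diff_divide_distrib)
  finally have 1: "g p N C = (D X Y N + D Y X N - D N X Y) / 2" .
  have "g p N (cov_deriv g p X Y dY) = g p N dY + g p N C"
    unfolding \<open>cov_deriv g p X Y dY = dY + C\<close> gram
    by (simp add: matrix_vector_mult_add_rdistrib matrix_vector_right_distrib inner_add_right)
  then show ?thesis using 1 sym by metis
qed

section \<open>The Bianchi-Cartan-Vranceanu metric\<close>

text \<open>Derivative of the coefficients only, not a covariant derivative. Here \<open>b'\<close>
  is the derivative along \<open>Z\<close> of the conformal factor, and \<open>\<omega>'\<close>
  that of the 1-form with its argument held constant.\<close>

definition bcv_metric_deriv :: "real \<Rightarrow> real \<Rightarrow> real^3 \<Rightarrow> real^3 \<Rightarrow> real^3 \<Rightarrow> real^3 \<Rightarrow> real" where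
  "bcv_metric_deriv \<kappa> \<tau> p Z V W =
    (let b = bcv_factor \<kappa> p; b' = \<kappa> / 2 * (p$1 * Z$1 + p$2 * Z$2);
         \<omega>' = (\<lambda>V. \<tau> * (Z$2 * V$1 - Z$1 * V$2) / b - \<tau> * (p$2 * V$1 - p$1 * V$2) * b' / b\<^sup>2)
     in \<omega>' V * bcv_form \<kappa> \<tau> p W + bcv_form \<kappa> \<tau> p V * \<omega>' W
        - 2 * (V$1 * W$1 + V$2 * W$2) * b' / b^3)"

lemma DERIV_bcv_metric:
  assumes b: "bcv_factor \<kappa> p > 0"
  shows "((\<lambda>s. bcv_metric \<kappa> \<tau> (p + s *\<^sub>R Z) V W) has_real_derivative bcv_metric_deriv \<kappa> \<tau> p Z V W) (at 0)"
proof -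
  have B: "((\<lambda>s. bcv_factor \<kappa> (p + s *\<^sub>R Z)) has_real_derivative \<kappa> / 2 * (p$1 * Z$1 + p$2 * Z$2)) (at 0)"
    unfolding bcv_factor_def by (auto intro!: derivative_eq_intros simp: algebra_simps)
  have F: "((\<lambda>s. bcv_form \<kappa> \<tau> (p + s *\<^sub>R Z) V) has_real_derivative 
      \<tau> * (Z$2 * V$1 - Z$1 * V$2) / bcv_factor \<kappa> p
      - \<tau> * (p$2 * V$1 - p$1 * V$2) * (\<kappa> / 2 * (p$1 * Z$1 + p$2 * Z$2)) / (bcv_factor \<kappa> p)\<^sup>2) (at 0)" for V
    unfolding bcv_form_def using b
    by (auto intro!: derivative_eq_intros B simp: field_simps power2_eq_square)
  have Q: "((\<lambda>s. (V$1 * W$1 + V$2 * W$2) / (bcv_factor \<kappa> (p + s *\<^sub>R Z))\<^sup>2) has_real_derivative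
      - (2 * (V$1 * W$1 + V$2 * W$2) * (\<kappa> / 2 * (p$1 * Z$1 + p$2 * Z$2)) / (bcv_factor \<kappa> p)^3)) (at 0)"
  proof (rule DERIV_cong[OF DERIV_divide[OF DERIV_const DERIV_power[OF B]]])
    show "(bcv_factor \<kappa> (p + 0 *\<^sub>R Z))\<^sup>2 \<noteq> 0"
      using b by simp
    have *: "(0 * b\<^sup>2 - c * (2 * (d * b))) / (b\<^sup>2 * b\<^sup>2) = - (2 * c * d / b^3)" if "b \<noteq> 0" for b c d :: real
      using that by (simp add: power2_eq_square power3_eq_cube ac_simps)
    show "(0 * (bcv_factor \<kappa> (p + 0 *\<^sub>R Z))\<^sup>2 - (V$1 * W$1 + V$2 * W$2) *
        (of_nat 2 * (\<kappa> / 2 * (p$1 * Z$1 + p$2 * Z$2) * bcv_factor \<kappa> (p + 0 *\<^sub>R Z) ^ (2 - Suc 0)))) /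
        ((bcv_factor \<kappa> (p + 0 *\<^sub>R Z))\<^sup>2 * (bcv_factor \<kappa> (p + 0 *\<^sub>R Z))\<^sup>2)
      = - (2 * (V$1 * W$1 + V$2 * W$2) * (\<kappa> / 2 * (p$1 * Z$1 + p$2 * Z$2)) / (bcv_factor \<kappa> p)^3)"
      using *[of "bcv_factor \<kappa> p"] b by (simp del: times_divide_eq_left times_divide_eq_right)
  qed
  show ?thesis
    unfolding bcv_metric_def
    by (rule DERIV_cong[OF DERIV_add[OF Q DERIV_mult[OF F F]]])
      (simp only: bcv_metric_deriv_def Let_def scaleR_zero_left add_0_left add_0_right diff_conv_add_uminus ac_simps)
qed

lemma bcv_gram: "bcv_metric \<kappa> \<tau> p v w = v \<bullet> (gram (bcv_metric \<kappa> \<tau>) p *v w)"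
proof -
  define e :: "3 \<Rightarrow> real^3" where "e i = axis i 1" for i
  have form: "bcv_form \<kappa> \<tau> p v = v$1 * bcv_form \<kappa> \<tau> p (e 1) + v$2 * bcv_form \<kappa> \<tau> p (e 2)
      + v$3 * bcv_form \<kappa> \<tau> p (e 3)" for v
    by (simp add: bcv_form_def e_def axis_def algebra_simps diff_divide_distrib)
  show ?thesis
    unfolding bcv_metric_def form[of v] form[of w]
    by (simp add: inner_vec_def matrix_vector_mult_def sum_3 gram_def bcv_metric_def
      flip: e_def) (simp add: e_def axis_def algebra_simps add_divide_distrib)
qed

lemma bcv_metric_commute: "bcv_metric \<kappa> \<tau> p v w = bcv_metric \<kappa> \<tau> p w v"
  by (simp add: bcv_metric_def mult.commute)

text \<open>The coframe \<open>dx/B\<close>, \<open>dy/B\<close>, \<open>bcv_form\<close> is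
  orthonormal and has determinant \<open>1/B^2\<close>, so the Gram determinant is its
  square.\<close>

lemma invertible_bcv_gram:
  assumes "bcv_factor \<kappa> p > 0"
  shows "invertible (gram (bcv_metric \<kappa> \<tau>) p)"
proof -
  have "det (gram (bcv_metric \<kappa> \<tau>) p) = 1 / (bcv_factor \<kappa> p)^4"
    using assms by (simp add: det_3 gram_def bcv_metric_def bcv_form_def axis_def field_simps
        power2_eq_square power4_eq_xxxx)
  then show ?thesis using assms by (simp add: invertible_det_nz)
qed

lemma metric_partial_bcv:
  assumes "bcv_factor \<kappa> p > 0"
  shows "metric_partial (bcv_metric \<kappa> \<tau>) p i j l
    = bcv_metric_deriv \<kappa> \<tau> p (axis i 1) (axis j 1) (axis l 1)"
  unfolding metric_partial_def gram_def
  using DERIV_imp_deriv[OF DERIV_bcv_metric[OF assms]] by simp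

lemma bcv_metric_deriv_linear:
  "bcv_metric_deriv \<kappa> \<tau> p Z V W = (\<Sum>i\<in>UNIV. bcv_metric_deriv \<kappa> \<tau> p (axis i 1) V W * Z $ i)"
  "bcv_metric_deriv \<kappa> \<tau> p Z V W = (\<Sum>i\<in>UNIV. bcv_metric_deriv \<kappa> \<tau> p Z (axis i 1) W * V $ i)"
  "bcv_metric_deriv \<kappa> \<tau> p Z V W = (\<Sum>i\<in>UNIV. bcv_metric_deriv \<kappa> \<tau> p Z V (axis i 1) * W $ i)"
  by (simp_all add: bcv_metric_deriv_def Let_def sum_3 axis_def bcv_form_def algebra_simps
      add_divide_distrib diff_divide_distrib)

text \<open>Trilinearity, in the form required by the hypothesis on \<open>D\<close> in
  \<open>metric_cov_deriv\<close>.\<close>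

lemma bcv_metric_deriv_sum:
  assumes "bcv_factor \<kappa> p > 0"
  shows "bcv_metric_deriv \<kappa> \<tau> p Z V W = (\<Sum>i\<in>UNIV. \<Sum>j\<in>UNIV. \<Sum>l\<in>UNIV.
     metric_partial (bcv_metric \<kappa> \<tau>) p i j l * Z $ i * V $ j * W $ l)"
proof -
  have "bcv_metric_deriv \<kappa> \<tau> p Z V W = (\<Sum>i\<in>UNIV. (\<Sum>j\<in>UNIV. (\<Sum>l\<in>UNIV.
     metric_partial (bcv_metric \<kappa> \<tau>) p i j l * W $ l) * V $ j) * Z $ i)"
    unfolding metric_partial_bcv[OF assms] bcv_metric_deriv_linear(3)[symmetric]
      bcv_metric_deriv_linear(2)[symmetric] bcv_metric_deriv_linear(1)[symmetric] ..
  then show ?thesis by (simp add: sum_distrib_right sum_distrib_left ac_simps)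
qed

section \<open>The orthonormal frame adapted to cylindrical coordinates\<close>

definition bcv_radial :: "real \<Rightarrow> real \<Rightarrow> real" where
  "bcv_radial \<kappa> r = 1 + \<kappa> / 4 * r\<^sup>2"

text \<open>\<open>bcv_frame \<kappa> \<tau> r \<theta> x y z\<close> has components \<open>x\<close>, \<open>y\<close>, \<open>z\<close> in the orthonormal frame
  \<open>B \<partial>\<^sub>r\<close>, \<open>(B/r) \<partial>\<^sub>\<theta> + \<tau> r \<partial>\<^sub>z\<close>, \<open>\<partial>\<^sub>z\<close>.\<close>

definition bcv_frame :: "real \<Rightarrow> real \<Rightarrow> real \<Rightarrow> real \<Rightarrow> real \<Rightarrow> real \<Rightarrow> real \<Rightarrow> real^3" where
  "bcv_frame \<kappa> \<tau> r \<theta> x y z = vector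
     [bcv_radial \<kappa> r * (x * cos \<theta> - y * sin \<theta>), bcv_radial \<kappa> r * (x * sin \<theta> + y * cos \<theta>), z + \<tau> * r * y]"

lemma bcv_factor_cylindrical [simp]: "bcv_factor \<kappa> (cylindrical r \<theta> z) = bcv_radial \<kappa> r"
  by (simp add: bcv_factor_def bcv_radial_def cylindrical_def power_mult_distrib flip: distrib_left)

text \<open>The metric and its derivative see the horizontal components of vectors only through such
  dot and cross products, with each other and with the base point. These are unchanged by a common
  rotation, so \<theta> disappears from all later formulas.\<close>

lemma bcv_frame_products:
  "bcv_frame \<kappa> \<tau> r \<theta> x y z $ 1 * bcv_frame \<kappa> \<tau> r \<theta> x' y' z' $ 1
    + bcv_frame \<kappa> \<tau> r \<theta> x y z $ 2 * bcv_frame \<kappa> \<tau> r \<theta> x' y' z' $ 2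
    = (bcv_radial \<kappa> r)\<^sup>2 * (x * x' + y * y')"
  "bcv_frame \<kappa> \<tau> r \<theta> x y z $ 2 * bcv_frame \<kappa> \<tau> r \<theta> x' y' z' $ 1
    - bcv_frame \<kappa> \<tau> r \<theta> x y z $ 1 * bcv_frame \<kappa> \<tau> r \<theta> x' y' z' $ 2
    = (bcv_radial \<kappa> r)\<^sup>2 * (y * x' - x * y')"
  "cylindrical r \<theta> \<zeta> $ 1 * bcv_frame \<kappa> \<tau> r \<theta> x y z $ 1
    + cylindrical r \<theta> \<zeta> $ 2 * bcv_frame \<kappa> \<tau> r \<theta> x y z $ 2 = bcv_radial \<kappa> r * r * x"
  "cylindrical r \<theta> \<zeta> $ 2 * bcv_frame \<kappa> \<tau> r \<theta> x y z $ 1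
    - cylindrical r \<theta> \<zeta> $ 1 * bcv_frame \<kappa> \<tau> r \<theta> x y z $ 2 = - (bcv_radial \<kappa> r * r * y)"
  by (simp_all add: bcv_frame_def cylindrical_def) (use sin_cos_squared_add[of \<theta>] in algebra)+

lemma bcv_form_frame:
  assumes "bcv_radial \<kappa> r \<noteq> 0"
  shows "bcv_form \<kappa> \<tau> (cylindrical r \<theta> \<zeta>) (bcv_frame \<kappa> \<tau> r \<theta> x y z) = z"
proof -
  have "bcv_frame \<kappa> \<tau> r \<theta> x y z $ 3 = z + \<tau> * r * y"
    by (simp add: bcv_frame_def)
  then show ?thesis
    using assms by (simp add: bcv_form_def bcv_frame_products)
qed

lemma bcv_metric_frame:
  assumes "bcv_radial \<kappa> r \<noteq> 0"
  shows "bcv_metric \<kappa> \<tau> (cylindrical r \<theta> \<zeta>) (bcv_frame \<kappa> \<tau> r \<theta> x y z) (bcv_frame \<kappa> \<tau> r \<theta> x' y' z')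
    = x * x' + y * y' + z * z'"
  using assms by (simp add: bcv_metric_def bcv_form_frame bcv_frame_products)

text \<open>The component \<open>z3\<close> is absent on the right because the metric coefficients
  do not depend on the height.\<close>

lemma bcv_metric_deriv_frame:
  assumes "bcv_radial \<kappa> r \<noteq> 0"
  shows "bcv_metric_deriv \<kappa> \<tau> (cylindrical r \<theta> \<zeta>) (bcv_frame \<kappa> \<tau> r \<theta> z1 z2 z3)
      (bcv_frame \<kappa> \<tau> r \<theta> v1 v2 v3) (bcv_frame \<kappa> \<tau> r \<theta> w1 w2 w3)
    = \<tau> * (bcv_radial \<kappa> r * (z2 * v1 - z1 * v2) + \<kappa> / 2 * r\<^sup>2 * z1 * v2) * w3
      + \<tau> * (bcv_radial \<kappa> r * (z2 * w1 - z1 * w2) + \<kappa> / 2 * r\<^sup>2 * z1 * w2) * v3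
      - \<kappa> * r * z1 * (v1 * w1 + v2 * w2)"
  unfolding bcv_metric_deriv_def Let_def bcv_form_frame[OF assms] bcv_frame_products mult.assoc bcv_factor_cylindrical
  using assms by (simp add: divide_simps power2_eq_square power3_eq_cube) (simp add: algebra_simps)

lemma det_bcv_frame:
  "det (vector [bcv_frame \<kappa> \<tau> r \<theta> x1 x2 x3, bcv_frame \<kappa> \<tau> r \<theta> y1 y2 y3, bcv_frame \<kappa> \<tau> r \<theta> z1 z2 z3] :: real^3^3)
    = (bcv_radial \<kappa> r)\<^sup>2 * (x1 * (y2 * z3 - y3 * z2) + x2 * (y3 * z1 - y1 * z3) + x3 * (y1 * z2 - y2 * z1))"
  by (simp add: det_3 bcv_frame_def) (use sin_cos_squared_add[of \<theta>] in algebra)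

text \<open>The base curve moves with frame components \<open>x1\<close>, \<open>x2\<close>, that is
  \<open>r' = B x1\<close> and \<open>\<theta>' = B x2 / r\<close>. The terms with
  \<open>\<kappa> / 2 * r * x1\<close> come from the derivative of the factor \<open>B\<close>,
  those with \<open>B * x2 / r\<close> from the rotation of the frame. The third entry is the
  derivative of \<open>y3 + \<tau> r y2\<close> minus \<open>\<tau> r\<close> times the new second
  entry.\<close>

lemma has_vector_derivative_bcv_frame:
  assumes r: "(r has_real_derivative bcv_radial \<kappa> (r s) * x1) (at s)" "r s \<noteq> 0"
    and \<theta>: "(\<theta> has_real_derivative bcv_radial \<kappa> (r s) * x2 / r s) (at s)"
    and y: "(y1 has_real_derivative y1') (at s)" "(y2 has_real_derivative y2') (at s)"
      "(y3 has_real_derivative y3') (at s)"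
  shows "((\<lambda>s. bcv_frame \<kappa> \<tau> (r s) (\<theta> s) (y1 s) (y2 s) (y3 s)) has_vector_derivative
    bcv_frame \<kappa> \<tau> (r s) (\<theta> s)
      (y1' + \<kappa> / 2 * r s * x1 * y1 s - bcv_radial \<kappa> (r s) * x2 * y2 s / r s)
      (y2' + \<kappa> / 2 * r s * x1 * y2 s + bcv_radial \<kappa> (r s) * x2 * y1 s / r s)
      (y3' + \<tau> * bcv_radial \<kappa> (r s) * (x1 * y2 s - x2 * y1 s) - \<kappa> / 2 * \<tau> * (r s)\<^sup>2 * x1 * y2 s)) (at s)"
proof -
  have B: "((\<lambda>s. bcv_radial \<kappa> (r s)) has_real_derivative \<kappa> / 2 * r s * (bcv_radial \<kappa> (r s) * x1)) (at s)"
    unfolding bcv_radial_def[of _ "r _"] using r(1)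
    by (auto intro!: derivative_eq_intros simp: bcv_radial_def)
  note D = DERIV_fun_cos[OF \<theta>] DERIV_fun_sin[OF \<theta>]
  show ?thesis
    unfolding bcv_frame_def
  proof (rule has_vector_derivative_vector_3, goal_cases)
    case 1
    show ?case
      by (rule DERIV_cong[OF DERIV_mult[OF B DERIV_diff[OF DERIV_mult[OF y(1) D(1)] DERIV_mult[OF y(2) D(2)]]]])
        (use r(2) in \<open>simp add: field_simps\<close>)
  next
    case 2
    show ?case
      by (rule DERIV_cong[OF DERIV_mult[OF B DERIV_add[OF DERIV_mult[OF y(1) D(2)] DERIV_mult[OF y(2) D(1)]]]])
        (use r(2) in \<open>simp add: field_simps\<close>)
  next
    case 3
    show ?case
      by (rule DERIV_cong[OF DERIV_add[OF y(3) DERIV_mult[OF DERIV_cmult[OF r(1)] y(2)]]])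
        (use r(2) in \<open>simp add: field_simps power2_eq_square\<close>)
  qed
qed

text \<open>The last argument of \<^const>\<open>cov_deriv\<close> is the Cartesian derivative computed in
  \<open>has_vector_derivative_bcv_frame\<close>.\<close>

lemma bcv_cov_deriv_frame:
  assumes B: "bcv_radial \<kappa> r > 0" and r: "r \<noteq> 0"
  shows "bcv_metric \<kappa> \<tau> (cylindrical r \<theta> \<zeta>)
      (cov_deriv (bcv_metric \<kappa> \<tau>) (cylindrical r \<theta> \<zeta>)
        (bcv_frame \<kappa> \<tau> r \<theta> x1 x2 x3) (bcv_frame \<kappa> \<tau> r \<theta> y1 y2 y3)
        (bcv_frame \<kappa> \<tau> r \<theta>
          (y1' + \<kappa> / 2 * r * x1 * y1 - bcv_radial \<kappa> r * x2 * y2 / r)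
          (y2' + \<kappa> / 2 * r * x1 * y2 + bcv_radial \<kappa> r * x2 * y1 / r)
          (y3' + \<tau> * bcv_radial \<kappa> r * (x1 * y2 - x2 * y1) - \<kappa> / 2 * \<tau> * r\<^sup>2 * x1 * y2)))
      (bcv_frame \<kappa> \<tau> r \<theta> n1 n2 n3)
    = y1' * n1 + y2' * n2 + y3' * n3 + (2 - bcv_radial \<kappa> r) / r * x2 * (y1 * n2 - y2 * n1)
      + \<tau> * (y3 * (x2 * n1 - x1 * n2) + x3 * (y2 * n1 - y1 * n2) + n3 * (x1 * y2 - x2 * y1))"
proof -
  define p where "p = cylindrical r \<theta> \<zeta>"
  have B0: "bcv_radial \<kappa> r \<noteq> 0" and p: "bcv_factor \<kappa> p > 0"
    using B by (simp_all add: p_def)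
  have eq: "bcv_metric \<kappa> \<tau> p (cov_deriv (bcv_metric \<kappa> \<tau>) p X Y dY) N = bcv_metric \<kappa> \<tau> p dY N
    + (bcv_metric_deriv \<kappa> \<tau> p X Y N + bcv_metric_deriv \<kappa> \<tau> p Y X N - bcv_metric_deriv \<kappa> \<tau> p N X Y) / 2"
    for X Y dY N
    by (rule metric_cov_deriv)
      (auto intro: bcv_gram bcv_metric_commute invertible_bcv_gram[OF p] bcv_metric_deriv_sum[OF p])
  show ?thesis
    unfolding p_def[symmetric] eq
    unfolding p_def bcv_metric_frame[OF B0] bcv_metric_deriv_frame[OF B0]
    \<comment> \<open>Unfolding \<open>bcv_radial\<close> is what merges the radial terms:
      \<open>B - \<kappa> r^2 / 2 = 2 - B\<close>.\<close>
    using r by (simp add: field_simps)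
      (simp add: bcv_radial_def algebra_simps power2_eq_square power3_eq_cube)
qed

section \<open>Mean curvature of helicoidal surfaces\<close>

lemma cylindrical_has_vector_derivative:
  assumes r: "(r has_real_derivative r') (at s)" and B: "bcv_radial \<kappa> (r s) \<noteq> 0"
    and \<theta>: "(\<theta> has_real_derivative \<theta>') (at s)"
    and z: "(z has_real_derivative z') (at s)"
  shows "((\<lambda>s. cylindrical (r s) (\<theta> s) (z s)) has_vector_derivative
    bcv_frame \<kappa> \<tau> (r s) (\<theta> s) (r' / bcv_radial \<kappa> (r s)) (r s * \<theta>' / bcv_radial \<kappa> (r s))
      (z' - \<tau> * (r s)\<^sup>2 * \<theta>' / bcv_radial \<kappa> (r s))) (at s)"
  unfolding cylindrical_def bcv_frame_def
  by (rule has_vector_derivative_vector_3; rule DERIV_cong,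
      (rule DERIV_mult[OF r DERIV_fun_cos[OF \<theta>]] DERIV_mult[OF r DERIV_fun_sin[OF \<theta>]] z)[1])
    (use B in \<open>simp_all add: field_simps power2_eq_square\<close>)

text \<open>In frame components the normal is the cross product of the first tangent vector with the
  second divided by its length \<open>l\<close>; the frame is positively oriented.\<close>

lemma bcv_unit_normal_frame:
  assumes B: "bcv_radial \<kappa> r > 0" and kw: "k\<^sup>2 + w\<^sup>2 = 1" and bc: "b\<^sup>2 + c\<^sup>2 = 1" and l: "l > 0"
  shows "unit_normal (bcv_metric \<kappa> \<tau>) (cylindrical r \<theta> \<zeta>)
      (bcv_frame \<kappa> \<tau> r \<theta> k (- c * w) (b * w)) (bcv_frame \<kappa> \<tau> r \<theta> 0 (l * b) (l * c))
    = bcv_frame \<kappa> \<tau> r \<theta> (- w) (- k * c) (k * b)"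
proof (rule unit_normal_eqI)
  have B0: "bcv_radial \<kappa> r \<noteq> 0" using B by simp
  show "invertible (gram (bcv_metric \<kappa> \<tau>) (cylindrical r \<theta> \<zeta>))"
    by (rule invertible_bcv_gram) (simp add: B)
  show "bcv_metric \<kappa> \<tau> (cylindrical r \<theta> \<zeta>) (bcv_frame \<kappa> \<tau> r \<theta> (- w) (- k * c) (k * b))
     (bcv_frame \<kappa> \<tau> r \<theta> k (- c * w) (b * w)) = 0"
    unfolding bcv_metric_frame[OF B0] using bc by algebra
  show "bcv_metric \<kappa> \<tau> (cylindrical r \<theta> \<zeta>) (bcv_frame \<kappa> \<tau> r \<theta> (- w) (- k * c) (k * b))
     (bcv_frame \<kappa> \<tau> r \<theta> 0 (l * b) (l * c)) = 0"
    unfolding bcv_metric_frame[OF B0] by algebra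
  show "bcv_metric \<kappa> \<tau> (cylindrical r \<theta> \<zeta>) (bcv_frame \<kappa> \<tau> r \<theta> (- w) (- k * c) (k * b))
     (bcv_frame \<kappa> \<tau> r \<theta> (- w) (- k * c) (k * b)) = 1"
    unfolding bcv_metric_frame[OF B0] using bc kw by algebra
  have "k * (l * b * (k * b) - l * c * (- k * c)) + - c * w * (l * c * (- w) - 0 * (k * b))
      + b * w * (0 * (- k * c) - l * b * (- w)) = l"
    using bc kw by algebra
  then show "det (vector [bcv_frame \<kappa> \<tau> r \<theta> k (- c * w) (b * w),
      bcv_frame \<kappa> \<tau> r \<theta> 0 (l * b) (l * c), bcv_frame \<kappa> \<tau> r \<theta> (- w) (- k * c) (k * b)] :: real^3^3) > 0"
    unfolding det_bcv_frame using B l by simp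
qed (rule bcv_gram bcv_metric_commute)+

text \<open>The hypotheses \<open>b\<close> and \<open>c\<close> say that the Killing field of the
  helicoidal motion, divided by \<open>m\<close>, has frame components \<open>U (0, b, c)\<close>.
  With \<open>k = cos \<sigma>\<close> and \<open>w = sin \<sigma>\<close>, the right side is the
  classical \<open>\<sigma>' + (1/r - \<kappa> r / 4) sin \<sigma>\<close>.\<close>

lemma mean_curvature_helicoidal:
  fixes r \<Theta> \<xi> k w b c U :: "real \<Rightarrow> real"
  assumes I: "open I" "u \<in> I"
    and \<psi>: "\<And>u t. \<psi> u t = cylindrical (r u) (t / m + \<Theta> u) (\<xi> u + a * (t / m + \<Theta> u))"
    and r: "\<And>v. v \<in> I \<Longrightarrow> r v > 0"
    and B: "\<And>v. v \<in> I \<Longrightarrow> bcv_radial \<kappa> (r v) > 0"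
    and U: "\<And>v. v \<in> I \<Longrightarrow> U v > 0"
    and r': "\<And>v. v \<in> I \<Longrightarrow> (r has_real_derivative bcv_radial \<kappa> (r v) * k v) (at v)"
    and \<Theta>': "\<And>v. v \<in> I \<Longrightarrow> (\<Theta> has_real_derivative - (bcv_radial \<kappa> (r v) * c v * w v / r v)) (at v)"
    and \<xi>': "\<And>v. v \<in> I \<Longrightarrow>
      (\<xi> has_real_derivative bcv_radial \<kappa> (r v) * U v * m * w v / r v) (at v)"
    and b: "\<And>v. v \<in> I \<Longrightarrow> bcv_radial \<kappa> (r v) * U v * m * b v = r v"
    and c: "\<And>v. v \<in> I \<Longrightarrow> bcv_radial \<kappa> (r v) * U v * m * c v = a * bcv_radial \<kappa> (r v) - \<tau> * (r v)\<^sup>2"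
    and bc: "\<And>v. v \<in> I \<Longrightarrow> (b v)\<^sup>2 + (c v)\<^sup>2 = 1"
    and kw: "\<And>v. v \<in> I \<Longrightarrow> (k v)\<^sup>2 + (w v)\<^sup>2 = 1"
    and D: "(b has_real_derivative b') (at u)" "(c has_real_derivative c') (at u)"
      "(k has_real_derivative k') (at u)" "(w has_real_derivative w') (at u)"
    and m: "m \<noteq> 0" and w: "w u \<noteq> 0"
  shows "mean_curvature (bcv_metric \<kappa> \<tau>) \<psi> u t
    = (2 - bcv_radial \<kappa> (r u)) / r u * w u - k' / w u"
proof -
  let ?B = "\<lambda>v. bcv_radial \<kappa> (r v)"
  let ?F = "\<lambda>v t. bcv_frame \<kappa> \<tau> (r v) (t / m + \<Theta> v)"
  \<comment> \<open>The vertical frame component of \<open>\<psi>\<^sub>u\<close>. Writing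
    \<open>w\<close> as \<open>(b^2 + c^2) w\<close> lets the hypotheses \<open>b\<close> and
    \<open>c\<close> replace the products with \<open>B U m\<close>.\<close>
  have bw: "?B v * U v * m * w v / r v + a * - (?B v * c v * w v / r v)
      - \<tau> * (r v)\<^sup>2 * - (?B v * c v * w v / r v) / ?B v = b v * w v" if v: "v \<in> I" for v
  proof -
    have "?B v * U v * m * (w v - (b v)\<^sup>2 * w v - (c v)\<^sup>2 * w v) = 0"
      using bc[OF v] by algebra
    then have "?B v * U v * m * w v = (r v * b v + (a * ?B v - \<tau> * (r v)\<^sup>2) * c v) * w v"
      using b[OF v] c[OF v] by algebra
    then show ?thesis
      using r[OF v] B[OF v] by (simp add: field_simps)
  qed
  have \<psi>u: "((\<lambda>s. \<psi> s t) has_vector_derivative ?F v t (k v) (- c v * w v) (b v * w v)) (at v)"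
    if v: "v \<in> I" for v t
  proof -
    have "((\<lambda>s. t / m + \<Theta> s) has_real_derivative - (?B v * c v * w v / r v)) (at v)"
      using DERIV_add[OF DERIV_const \<Theta>'[OF v]] by simp
    note * = this DERIV_add[OF \<xi>'[OF v] DERIV_cmult[OF this, of a]]
    show ?thesis
      unfolding \<psi>
      using cylindrical_has_vector_derivative[OF r'[OF v] less_imp_neq[OF B[OF v], symmetric] *,
          where \<tau> = \<tau>, unfolded bw[OF v]] r[OF v] B[OF v] by simp
  qed
  have tm: "((\<lambda>s. s / m + \<Theta> v) has_real_derivative 1 / m) (at t)" for v t
    using m by (auto intro!: derivative_eq_intros)
  have \<psi>t: "((\<lambda>s. \<psi> v s) has_vector_derivative ?F v t 0 (U v * b v) (U v * c v)) (at t)"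
    if v: "v \<in> I" for v t
  proof -
    have z: "((\<lambda>s. \<xi> v + a * (s / m + \<Theta> v)) has_real_derivative a / m) (at t)"
      using m by (auto intro!: derivative_eq_intros)
    have "r v * (1 / m) / ?B v = U v * b v" 
      using b[OF v] B[OF v] m by (simp add: field_simps)
    moreover have "a / m - \<tau> * (r v)\<^sup>2 * (1 / m) / ?B v = U v * c v" 
      using c[OF v] B[OF v] m by (simp add: field_simps)
    ultimately show ?thesis
      unfolding \<psi>
      using cylindrical_has_vector_derivative[OF DERIV_const less_imp_neq[OF B[OF v], symmetric] tm[of v t] z, where \<tau> = \<tau>]
      by simp
  qed
  have pu: "partial_u \<psi> v t = ?F v t (k v) (- c v * w v) (b v * w v)" if "v \<in> I" for v t
    unfolding partial_u_def by (rule vector_derivative_at[OF \<psi>u[OF that]])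
  have pt: "partial_t \<psi> v t = ?F v t 0 (U v * b v) (U v * c v)" if "v \<in> I" for v t
    unfolding partial_t_def by (rule vector_derivative_at[OF \<psi>t[OF that]])
  note u = I(2)
  have x2: "((\<lambda>v. - c v * w v) has_real_derivative - c' * w u - c u * w') (at u)"
    by (rule DERIV_cong[OF DERIV_mult[OF DERIV_minus[OF D(2)] D(4)]]) simp
  have x3: "((\<lambda>v. b v * w v) has_real_derivative b' * w u + b u * w') (at u)"
    by (rule DERIV_cong[OF DERIV_mult[OF D(1) D(4)]]) simp
  have \<theta>u: "((\<lambda>s. t / m + \<Theta> s) has_real_derivative ?B u * (- c u * w u) / r u) (at u)"
    using DERIV_add[OF DERIV_const \<Theta>'[OF u]] by (simp add: mult.assoc)
  note puu = has_vector_derivative_bcv_frame[where r = r, OF r'[OF u] less_imp_neq[OF r[OF u], symmetric] \<theta>u D(3) x2 x3, where \<tau> = \<tau>]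
  \<comment> \<open>The frame expression for \<open>partial_u \<psi>\<close> is known only over
    \<open>I\<close>, so differentiating it again at \<open>u\<close> uses that \<open>I\<close> is
    open.\<close>
  have "((\<lambda>s. partial_u \<psi> s t) has_vector_derivative v) (at u) \<longleftrightarrow>
     ((\<lambda>s. ?F s t (k s) (- c s * w s) (b s * w s)) has_vector_derivative v) (at u)" for v
    using pu I by (auto intro: has_vector_derivative_transform_within_open[OF _ I])
  note puu = vector_derivative_at[OF this[THEN iffD2, OF puu], folded partial_u_def]
  have "1 / m = ?B u * (U u * b u) / r u"
    using b[OF u] r[OF u] m by (simp add: field_simps)
  then have \<theta>t: "((\<lambda>s. s / m + \<Theta> u) has_real_derivative ?B u * (U u * b u) / r u) (at t)"
    using tm by simp
  have "((\<lambda>t. r u) has_real_derivative ?B u * 0) (at t)" by simp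
  \<comment> \<open>Along an orbit the radius and the frame components are constant, so only the
    rotation of the frame contributes.\<close>
  note ptt = has_vector_derivative_bcv_frame[where r = "\<lambda>_. r u", OF this less_imp_neq[OF r[OF u], symmetric] \<theta>t
    DERIV_const DERIV_const DERIV_const, where \<tau> = \<tau>, of 0 "U u * b u" "U u * c u"]
  note ptt = vector_derivative_at[OF ptt, folded pt[OF u], folded partial_t_def]
  note N = bcv_unit_normal_frame[OF B[OF u] kw[OF u] bc[OF u] U[OF u], of \<tau> "t / m + \<Theta> u" "\<xi> u + a * (t / m + \<Theta> u)"]
  have B0: "bcv_radial \<kappa> (r u) \<noteq> 0" using B[OF u] by simp
  note cd = bcv_cov_deriv_frame[OF B[OF u] less_imp_neq[OF r[OF u], symmetric]]
  let ?E = "k u * k u + - c u * w u * (- c u * w u) + b u * w u * (b u * w u)"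
  let ?Ff = "k u * 0 + - c u * w u * (U u * b u) + b u * w u * (U u * c u)"
  let ?G = "0 * 0 + U u * b u * (U u * b u) + U u * c u * (U u * c u)"
  \<comment> \<open>The first fundamental form is \<open>du^2 + U^2 dt^2\<close>; as
    \<open>F = 0\<close>, the trace reduces to \<open>L + K / U^2\<close>.\<close>
  have EFG: "?E = 1" "?Ff = 0" "?G = (U u)\<^sup>2"
  proof -
    show "?E = 1" using kw[OF u] bc[OF u] by algebra
    show "?Ff = 0" by simp
    have "?G = (U u)\<^sup>2 * ((b u)\<^sup>2 + (c u)\<^sup>2)" by (simp add: power2_eq_square algebra_simps)
    then show "?G = (U u)\<^sup>2" using bc[OF u] by simp
  qed
  have bc': "b u * b' + c u * c' = 0"
    by (rule DERIV_sum_squares_eq_1[OF I bc D(1,2)])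
  have kw': "k u * k' + w u * w' = 0"
    by (rule DERIV_sum_squares_eq_1[OF I kw D(3,4)])
  define q where "q = (2 - bcv_radial \<kappa> (r u)) / r u"
  \<comment> \<open>Clearing \<open>d\<close> and \<open>w\<close> leaves a polynomial identity
    modulo the two unit-length relations and their derivatives \<open>bc'\<close> and
    \<open>kw'\<close>.\<close>
  have frac: "n / d = q * w u - k' / w u" if "n * w u = d * (q * w u * w u - k')" "d \<noteq> 0" for n d
    using that w by (simp add: field_simps)
  show ?thesis
    unfolding mean_curvature_def Let_def pu[OF u] pt[OF u] puu ptt
    unfolding \<psi> N cd bcv_metric_frame[OF B0] EFG q_def[symmetric]
    by (simp, rule frac) (use bc[OF u] kw[OF u] bc' kw' in algebra, use U[OF u] in simp)
qed

section \<open>Algebra and derivatives of the explicit functions of \<open>U\<close>\<close>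

text \<open>Since \<open>x / 0 = 0\<close> and \<open>sqrt\<close> is negative on negative reals,
  positivity of \<open>hel_xi1\<close> already encodes that the defining quotient is meaningful and
  positive.\<close>

lemma hel_xi1_pos_imp:
  assumes "hel_xi1 \<kappa> \<tau> U m a u > 0"
  shows "hel_denom \<kappa> \<tau> U m a u \<noteq> 0"
    and "(hel_xi1 \<kappa> \<tau> U m a u)\<^sup>2 = 4 * (m\<^sup>2 * (U u)\<^sup>2 - a\<^sup>2) / hel_denom \<kappa> \<tau> U m a u"
    and "(m\<^sup>2 * (U u)\<^sup>2 - a\<^sup>2) / hel_denom \<kappa> \<tau> U m a u > 0"
  using assms by (auto simp: hel_xi1_def power_mult_distrib)

text \<open>Expanding \<open>hel_denom\<close> with the square of \<open>sqrt \<Delta>\<close>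
  replaced by \<Delta> shows that \<open>hel_denom + \<kappa> (m^2 U^2 - a^2)\<close> is the
  numerator of \<open>hel_B\<close>.\<close>

lemma hel_B_eq_bcv_radial:
  assumes "hel_Delta \<kappa> \<tau> U m a u > 0" "hel_xi1 \<kappa> \<tau> U m a u > 0"
  shows "hel_B \<kappa> \<tau> U m a u = bcv_radial \<kappa> (hel_xi1 \<kappa> \<tau> U m a u)"
proof -
  let ?D = "hel_denom \<kappa> \<tau> U m a u" and ?s = "sqrt (hel_Delta \<kappa> \<tau> U m a u)"
  have "?s\<^sup>2 = (1 - 2*a*\<tau>)\<^sup>2 + (m\<^sup>2 * (U u)\<^sup>2 - a\<^sup>2) * (4*\<tau>\<^sup>2 - \<kappa>)"
    using assms(1) by (simp add: hel_Delta_def)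
  moreover have "?D = (1 + ?s)\<^sup>2 - 4 * \<tau>\<^sup>2 * m\<^sup>2 * (U u)\<^sup>2"
    by (simp add: hel_denom_def)
  ultimately have "2 * (1 - 2*a*\<tau> + ?s) = ?D + \<kappa> * (m\<^sup>2 * (U u)\<^sup>2 - a\<^sup>2)"
    by algebra
  then have "hel_B \<kappa> \<tau> U m a u = (?D + \<kappa> * (m\<^sup>2 * (U u)\<^sup>2 - a\<^sup>2)) / ?D"
    by (simp add: hel_B_def)
  then show ?thesis
    using hel_xi1_pos_imp(1,2)[OF assms(2)] by (simp add: bcv_radial_def add_divide_distrib) (simp add: field_simps)
qed

text \<open>Divided by \<open>(m B)^2\<close>, this says that the orbits have speed
  \<open>U\<close>; it becomes the relation \<open>b^2 + c^2 = 1\<close>.\<close>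

lemma hel_orbit_speed:
  assumes "hel_Delta \<kappa> \<tau> U m a u > 0" "hel_xi1 \<kappa> \<tau> U m a u > 0"
  shows "(hel_B \<kappa> \<tau> U m a u * U u * m)\<^sup>2 = (hel_xi1 \<kappa> \<tau> U m a u)\<^sup>2
    + (a * hel_B \<kappa> \<tau> U m a u - \<tau> * (hel_xi1 \<kappa> \<tau> U m a u)\<^sup>2)\<^sup>2"
proof -
  let ?D = "hel_denom \<kappa> \<tau> U m a u" and ?s = "sqrt (hel_Delta \<kappa> \<tau> U m a u)"
  let ?B = "hel_B \<kappa> \<tau> U m a u" and ?r = "hel_xi1 \<kappa> \<tau> U m a u"
  note D = hel_xi1_pos_imp[OF assms(2)]
  \<comment> \<open>The claim multiplied by \<open>hel_denom^2\<close>, with \<open>s\<close> for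
    \<open>sqrt \<Delta>\<close> and \<open>M\<close> for \<open>m^2 U^2\<close>.\<close>
  have ring: "(2 * (1 - 2*a*\<tau> + s))\<^sup>2 * M = ((1 + s)\<^sup>2 - 4 * \<tau>\<^sup>2 * M) * (4 * (M - a\<^sup>2))
      + (a * (2 * (1 - 2*a*\<tau> + s)) - \<tau> * (4 * (M - a\<^sup>2)))\<^sup>2" for s M
    by algebra
  have Du: "?D = (1 + ?s)\<^sup>2 - 4 * \<tau>\<^sup>2 * m\<^sup>2 * (U u)\<^sup>2"
    by (simp add: hel_denom_def)
  have DB: "?D * ?B = 2 * (1 - 2*a*\<tau> + ?s)" and Dr: "?D * ?r\<^sup>2 = 4 * (m\<^sup>2 * (U u)\<^sup>2 - a\<^sup>2)"
    using D by (simp_all add: hel_B_def)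
  have "?D\<^sup>2 * (?B * U u * m)\<^sup>2 = (?D * ?B)\<^sup>2 * (m\<^sup>2 * (U u)\<^sup>2)"
    by (simp add: power_mult_distrib)
  also have "\<dots> = ?D * (?D * ?r\<^sup>2) + (a * (?D * ?B) - \<tau> * (?D * ?r\<^sup>2))\<^sup>2"
    unfolding DB Dr unfolding Du using ring[of ?s "m\<^sup>2 * (U u)\<^sup>2"] by (simp only: mult.assoc)
  also have "\<dots> = ?D\<^sup>2 * (?r\<^sup>2 + (a * ?B - \<tau> * ?r\<^sup>2)\<^sup>2)"
    by algebra
  finally have "?D\<^sup>2 * (?B * U u * m)\<^sup>2 = ?D\<^sup>2 * (?r\<^sup>2 + (a * ?B - \<tau> * ?r\<^sup>2)\<^sup>2)" .
  then show ?thesis using D(1) by simp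
qed

lemma DERIV_hel_Delta:
  assumes "(U has_real_derivative U') (at u)"
  shows "(hel_Delta \<kappa> \<tau> U m a has_real_derivative 2 * m\<^sup>2 * U u * U' * (4*\<tau>\<^sup>2 - \<kappa>)) (at u)"
  unfolding hel_Delta_def[abs_def] using assms by (auto intro!: derivative_eq_intros)

text \<open>With \<open>P = m^2 U U' / sqrt \<Delta>\<close> this reads \<open>r' = B k\<close> for
  \<open>k = P B / r\<close>, so \<open>k\<close> is the radial frame component of
  \<open>\<psi>\<^sub>u\<close>.\<close>

lemma DERIV_hel_xi1:
  assumes \<Delta>: "hel_Delta \<kappa> \<tau> U m a u > 0" and r: "hel_xi1 \<kappa> \<tau> U m a u > 0"
    and U: "(U has_real_derivative U') (at u)"
  shows "(hel_xi1 \<kappa> \<tau> U m a has_real_derivative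
    m\<^sup>2 * U u * U' * (hel_B \<kappa> \<tau> U m a u)\<^sup>2
      / (sqrt (hel_Delta \<kappa> \<tau> U m a u) * hel_xi1 \<kappa> \<tau> U m a u)) (at u)"
proof -
  let ?D = "hel_denom \<kappa> \<tau> U m a" and ?s = "sqrt (hel_Delta \<kappa> \<tau> U m a u)"
  define q where "q v = m\<^sup>2 * (U v)\<^sup>2 - a\<^sup>2" for v
  define q' where "q' = 2 * m\<^sup>2 * U u * U'"
  define D' where "D' = (1 + ?s) * q' * (4*\<tau>\<^sup>2 - \<kappa>) / ?s - 4 * \<tau>\<^sup>2 * q'"
  have s: "?s > 0" using \<Delta> by simp
  note D = hel_xi1_pos_imp[OF r, folded q_def]
  have q: "(q has_real_derivative q') (at u)"
    unfolding q_def[abs_def] q'_def using U by (auto intro!: derivative_eq_intros)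
  have S: "((\<lambda>v. sqrt (hel_Delta \<kappa> \<tau> U m a v)) has_real_derivative q' * (4*\<tau>\<^sup>2 - \<kappa>) / (2 * ?s)) (at u)"
    using DERIV_sqrt_comp[OF DERIV_hel_Delta[OF U] \<Delta>] by (simp add: q'_def)
  have D': "(?D has_real_derivative D') (at u)"
    unfolding hel_denom_def[abs_def]
    by (rule DERIV_cong[OF DERIV_diff[OF DERIV_power[OF DERIV_add[OF DERIV_const S], where n = 2]
            DERIV_cmult[OF DERIV_power[OF U, where n = 2]]]])
      (use s in \<open>simp add: D'_def q'_def field_simps\<close>)
  have s2: "?s\<^sup>2 = (1 - 2*a*\<tau>)\<^sup>2 + q u * (4*\<tau>\<^sup>2 - \<kappa>)"
    using \<Delta> by (simp add: hel_Delta_def q_def)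
  have Du: "?D u = (1 + ?s)\<^sup>2 - 4 * \<tau>\<^sup>2 * (q u + a\<^sup>2)"
    by (simp add: hel_denom_def q_def)
  have "?s * D' = (1 + ?s) * q' * (4*\<tau>\<^sup>2 - \<kappa>) - 4 * \<tau>\<^sup>2 * q' * ?s"
    using s by (simp add: D'_def field_simps)
  \<comment> \<open>The numerator of the quotient rule collapses to a perfect square, which is what
    produces \<open>hel_B\<close> squared.\<close>
  with s2 Du have key: "?s * (q' * ?D u - q u * D') = q' * (1 - 2*a*\<tau> + ?s)\<^sup>2"
    by algebra
  have quot: "((\<lambda>v. q v / ?D v) has_real_derivative (q' * ?D u - q u * D') / (?D u * ?D u)) (at u)"
    by (rule DERIV_divide[OF q D' D(1)])
  have eq: "(q' * ?D u - q u * D') / (?D u * ?D u) = q' * (hel_B \<kappa> \<tau> U m a u)\<^sup>2 / (4 * ?s)"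
  proof -
    define y where "y = 1 - 2*a*\<tau> + ?s"
    have "q' * ?D u - q u * D' = q' * y\<^sup>2 / ?s"
      using key s by (simp add: eq_divide_eq mult.commute y_def)
    then show ?thesis
      by (simp add: hel_B_def power_divide power_mult_distrib power2_eq_square[of "?D u"] flip: y_def)
  qed
  have root: "sqrt (q u / ?D u) = hel_xi1 \<kappa> \<tau> U m a u / 2"
    by (simp add: hel_xi1_def q_def)
  have "((\<lambda>v. 2 * sqrt (q v / ?D v)) has_real_derivative
      2 * ((q' * ?D u - q u * D') / (?D u * ?D u) / (2 * sqrt (q u / ?D u)))) (at u)"
    by (rule DERIV_cmult[OF DERIV_sqrt_comp[OF quot D(3)]])
  then have "((\<lambda>v. 2 * sqrt (q v / ?D v)) has_real_derivative
      m\<^sup>2 * U u * U' * (hel_B \<kappa> \<tau> U m a u)\<^sup>2 / (?s * hel_xi1 \<kappa> \<tau> U m a u)) (at u)"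
    unfolding eq root using r s
    by (elim DERIV_cong) (simp add: q'_def field_simps)
  then show ?thesis
    by (simp add: hel_xi1_def[abs_def] q_def)
qed

text \<open>From \<open>4 + \<kappa> r^2 = 4 B\<close>. The result is
  \<open>r^2 - (P B)^2 = r^2 (1 - k^2)\<close>, the square of \<open>r w\<close>.\<close>

lemma hel_radicand_eq:
  assumes "hel_Delta \<kappa> \<tau> U m a u > 0" "hel_xi1 \<kappa> \<tau> U m a u > 0"
  shows "hel_radicand \<kappa> \<tau> U m a u = (hel_xi1 \<kappa> \<tau> U m a u)\<^sup>2
    - (m\<^sup>2 * U u * deriv U u * hel_B \<kappa> \<tau> U m a u / sqrt (hel_Delta \<kappa> \<tau> U m a u))\<^sup>2"
proof -
  have *: "4 + \<kappa> * (hel_xi1 \<kappa> \<tau> U m a u)\<^sup>2 = 4 * hel_B \<kappa> \<tau> U m a u"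
    unfolding hel_B_eq_bcv_radial[OF assms] by (simp add: bcv_radial_def)
  show ?thesis
    unfolding hel_radicand_def * using assms(1)
    by (simp add: power_mult_distrib power_divide flip: power_mult)
qed

text \<open>Feeds the explicit data into \<open>mean_curvature_helicoidal\<close>. Taking
  \<open>w\<close> as the positive root of \<open>1 - k^2\<close> agrees with the sign of the root
  in both integrands, so \<open>sqrt R = r w\<close>.\<close>

lemma mean_curvature_hel:
  fixes \<kappa> \<tau> m a :: real and U :: "real \<Rightarrow> real"
  defines "\<Delta> \<equiv> hel_Delta \<kappa> \<tau> U m a" and "B \<equiv> hel_B \<kappa> \<tau> U m a"
    and "r \<equiv> hel_xi1 \<kappa> \<tau> U m a" and "R \<equiv> hel_radicand \<kappa> \<tau> U m a"
  assumes I: "open I" "u \<in> I" and m: "m \<noteq> 0"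
    and U: "\<And>v. v \<in> I \<Longrightarrow> U v > 0"
    and U': "\<And>v. v \<in> I \<Longrightarrow> (U has_real_derivative deriv U v) (at v)"
    and U'': "(deriv U has_real_derivative U'') (at u)"
    and \<Delta>: "\<And>v. v \<in> I \<Longrightarrow> \<Delta> v > 0"
    and r: "\<And>v. v \<in> I \<Longrightarrow> r v > 0"
    and R: "\<And>v. v \<in> I \<Longrightarrow> R v > 0"
    and \<xi>: "primitive_on I (hel_xi2_integrand \<kappa> \<tau> U m a) \<xi>"
    and \<Theta>: "primitive_on I (hel_theta_integrand \<kappa> \<tau> U m a) \<Theta>"
    and B_pos: "\<And>v. v \<in> I \<Longrightarrow> B v > 0"
  shows "mean_curvature (bcv_metric \<kappa> \<tau>) (helicoidal_surface \<kappa> \<tau> U m a \<xi> \<Theta>) u t * sqrt (R u)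
    = 2 - B u - m\<^sup>2 * B u * deriv (\<lambda>v. U v * deriv U v / sqrt (\<Delta> v)) u"
proof -
  have B: "B v = bcv_radial \<kappa> (r v)" if "v \<in> I" for v
    using hel_B_eq_bcv_radial \<Delta>[OF that] r[OF that] unfolding \<Delta>_def B_def r_def by blast
  define P where "P v = m\<^sup>2 * (U v * deriv U v / sqrt (\<Delta> v))" for v
  define k where "k v = P v * bcv_radial \<kappa> (r v) / r v" for v
  define w where "w v = sqrt (1 - (k v)\<^sup>2)" for v
  define b where "b v = r v / (bcv_radial \<kappa> (r v) * U v * m)" for v
  define c where "c v = (a * bcv_radial \<kappa> (r v) - \<tau> * (r v)\<^sup>2) / (bcv_radial \<kappa> (r v) * U v * m)" for v
  have r': "(r has_real_derivative bcv_radial \<kappa> (r v) * k v) (at v)" if v: "v \<in> I" for v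
    using DERIV_hel_xi1[of \<kappa> \<tau> U m a v, folded \<Delta>_def r_def B_def, OF \<Delta>[OF v] r[OF v] U'[OF v]]
    by (simp add: B[OF v] k_def P_def power2_eq_square mult_ac)
  have Rk: "R v = (r v)\<^sup>2 * (1 - (k v)\<^sup>2)" if v: "v \<in> I" for v
  proof -
    have "R v = (r v)\<^sup>2 - (P v * B v)\<^sup>2"
      using hel_radicand_eq[of \<kappa> \<tau> U m a v, folded \<Delta>_def r_def R_def B_def, OF \<Delta>[OF v] r[OF v]]
      by (simp add: P_def mult_ac)
    also have "P v * B v = r v * k v"
      using r[OF v] by (simp add: k_def B[OF v])
    finally show ?thesis by (simp add: power_mult_distrib right_diff_distrib)
  qed
  \<comment> \<open>Strict positivity of the radicand keeps \<open>w\<close> away from zero, where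
    the root would not be differentiable and \<open>k' / w\<close> would be meaningless.\<close>
  have k1: "1 - (k v)\<^sup>2 > 0" if v: "v \<in> I" for v
    using R[OF v] r[OF v] unfolding Rk[OF v] by (simp add: zero_less_mult_iff)
  have kw: "(k v)\<^sup>2 + (w v)\<^sup>2 = 1" and w: "w v > 0" and sqR: "sqrt (R v) = r v * w v"
    if v: "v \<in> I" for v
    using k1[OF v] r[OF v] by (simp_all add: w_def Rk[OF v] real_sqrt_mult)
  have Bp: "bcv_radial \<kappa> (r v) > 0" if "v \<in> I" for v
    using B_pos[OF that] B[OF that] by simp
  have four: "4 + \<kappa> * (r v)\<^sup>2 = 4 * bcv_radial \<kappa> (r v)" for v
    by (simp add: bcv_radial_def)
  have bc: "(b v)\<^sup>2 + (c v)\<^sup>2 = 1" if v: "v \<in> I" for v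
  proof -
    have "(b v)\<^sup>2 + (c v)\<^sup>2 = (bcv_radial \<kappa> (r v) * U v * m)\<^sup>2 / (bcv_radial \<kappa> (r v) * U v * m)\<^sup>2"
      using hel_orbit_speed[of \<kappa> \<tau> U m a v, folded \<Delta>_def r_def B_def, OF \<Delta>[OF v] r[OF v]]
      by (simp only: B[OF v] b_def c_def power_divide add_divide_distrib)
    then show ?thesis
      using U[OF v] m Bp[OF v] by simp
  qed
  have \<xi>': "(\<xi> has_real_derivative bcv_radial \<kappa> (r v) * U v * m * w v / r v) (at v)" if v: "v \<in> I" for v
  proof -
    have "(\<xi> has_real_derivative hel_xi2_integrand \<kappa> \<tau> U m a v) (at v)"
      using \<xi> v unfolding primitive_on_def by blast
    then show ?thesis
      unfolding hel_xi2_integrand_def r_def[symmetric] R_def[symmetric] sqR[OF v] four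
      using r[OF v] by (simp add: power2_eq_square mult_ac)
  qed
  have \<Theta>': "(\<Theta> has_real_derivative - (bcv_radial \<kappa> (r v) * c v * w v / r v)) (at v)" if v: "v \<in> I" for v
  proof -
    have "(\<Theta> has_real_derivative hel_theta_integrand \<kappa> \<tau> U m a v) (at v)"
      using \<Theta> v unfolding primitive_on_def by blast
    \<comment> \<open>Up to the factor -4 this is the numerator of \<open>c\<close>, which turns the
      integrand into \<open>- B c w / r\<close>.\<close>
    moreover have "(4*\<tau> - a*\<kappa>) * (r v)\<^sup>2 - 4*a = 4 * (\<tau> * (r v)\<^sup>2 - a * bcv_radial \<kappa> (r v))"
      by (simp add: bcv_radial_def algebra_simps)
    ultimately have "(\<Theta> has_real_derivative 4 * (\<tau> * (r v)\<^sup>2 - a * bcv_radial \<kappa> (r v))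
        / (4 * m * U v * (r v)\<^sup>2) * (r v * w v)) (at v)"
      unfolding hel_theta_integrand_def r_def[symmetric] R_def[symmetric] sqR[OF v] by simp
    then show ?thesis
      by (rule DERIV_cong) (use r[OF v] Bp[OF v] U[OF v] m in
          \<open>simp add: c_def field_simps power2_eq_square\<close>)
  qed
  note u = I(2)
  from DERIV_divide[OF DERIV_mult[OF U'[OF u] U'']
      DERIV_sqrt_comp[OF DERIV_hel_Delta[OF U'[OF u], where \<kappa> = \<kappa> and \<tau> = \<tau> and m = m and a = a, folded \<Delta>_def] \<Delta>[OF u]]]
  \<comment> \<open>Differentiability has to be shown so that the \<open>deriv\<close> in the
    equation is a genuine derivative.\<close>
  have "(\<lambda>v. U v * deriv U v / sqrt (\<Delta> v)) field_differentiable (at u)"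
    using \<Delta>[OF u] unfolding field_differentiable_def by fastforce
  then have P': "(P has_real_derivative m\<^sup>2 * deriv (\<lambda>v. U v * deriv U v / sqrt (\<Delta> v)) u) (at u)"
    unfolding P_def[abs_def] by (intro DERIV_cmult field_differentiable_derivI)
  define P' where "P' = m\<^sup>2 * deriv (\<lambda>v. U v * deriv U v / sqrt (\<Delta> v)) u"
  have rad': "((\<lambda>v. bcv_radial \<kappa> (r v)) has_real_derivative \<kappa> / 2 * r u * (bcv_radial \<kappa> (r u) * k u)) (at u)"
    unfolding bcv_radial_def[of _ "r _"] using r'[OF u]
    by (auto intro!: derivative_eq_intros simp: bcv_radial_def)
  define k' where "k' = ((P' * bcv_radial \<kappa> (r u) + \<kappa> / 2 * r u * (bcv_radial \<kappa> (r u) * k u) * P u) * r u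
      - P u * bcv_radial \<kappa> (r u) * (bcv_radial \<kappa> (r u) * k u)) / (r u * r u)"
  have k': "(k has_real_derivative k') (at u)"
    unfolding k_def[abs_def] k'_def
    using DERIV_divide[OF DERIV_mult[OF P'[folded P'_def] rad'] r'[OF u]] r[OF u]
    by (simp add: k_def)
  have w': "(w has_real_derivative (0 - 2 * k u * k') / (2 * sqrt (1 - (k u)\<^sup>2))) (at u)"
    unfolding w_def[abs_def]
    by (rule DERIV_sqrt_comp[where f = "\<lambda>v. 1 - (k v)\<^sup>2", OF _ k1[OF u]])
      (use k' in \<open>auto intro!: derivative_eq_intros\<close>)
  have den: "bcv_radial \<kappa> (r u) * U u * m \<noteq> 0"
    using Bp[OF u] U[OF u] m by simp
  note den' = DERIV_mult[OF DERIV_mult[OF rad' U'[OF u]] DERIV_const[of m]]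
  note b' = DERIV_divide[OF r'[OF u] den' den, folded b_def]
  note c' = DERIV_divide[OF DERIV_diff[OF DERIV_cmult[OF rad', where c = a] DERIV_cmult[OF DERIV_power[OF r'[OF u], where n = 2], where c = \<tau>]] den' den, folded c_def]
  have surf: "helicoidal_surface \<kappa> \<tau> U m a \<xi> \<Theta> v t
      = cylindrical (r v) (t / m + \<Theta> v) (\<xi> v + a * (t / m + \<Theta> v))" for v t
    by (simp add: helicoidal_surface_def r_def Let_def)
  have H: "mean_curvature (bcv_metric \<kappa> \<tau>) (helicoidal_surface \<kappa> \<tau> U m a \<xi> \<Theta>) u t
      = (2 - bcv_radial \<kappa> (r u)) / r u * w u - k' / w u"
  proof (rule mean_curvature_helicoidal[where I = I and r = r and \<Theta> = \<Theta> and \<xi> = \<xi> and k = k and w = w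
        and b = b and c = c and U = U, OF I surf r Bp U r' \<Theta>' \<xi>' _ _ bc kw b' c' k' w' m less_imp_neq[OF w[OF u], symmetric]])
    show "bcv_radial \<kappa> (r v) * U v * m * b v = r v"
      "bcv_radial \<kappa> (r v) * U v * m * c v = a * bcv_radial \<kappa> (r v) - \<tau> * (r v)\<^sup>2" if "v \<in> I" for v
      using Bp[OF that] U[OF that] m by (simp_all add: b_def c_def)
  qed
  have "P u * bcv_radial \<kappa> (r u) = k u * r u"
    using r[OF u] by (simp add: k_def)
  \<comment> \<open>Here \<open>P B\<close> is replaced by \<open>k r\<close> in the quotient rule
    for \<open>k'\<close>.\<close>
  then have "r u * (r u * k')
      = r u * (P' * bcv_radial \<kappa> (r u) + (\<kappa> / 2 * (r u)\<^sup>2 - bcv_radial \<kappa> (r u)) * (k u)\<^sup>2)"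
    unfolding k'_def using r[OF u] by simp algebra
  then have rk': "r u * k' = P' * bcv_radial \<kappa> (r u) + (\<kappa> / 2 * (r u)\<^sup>2 - bcv_radial \<kappa> (r u)) * (k u)\<^sup>2"
    using r[OF u] by simp
  have "((2 - bcv_radial \<kappa> (r u)) / r u * w u - k' / w u) * (r u * w u)
      = (2 - bcv_radial \<kappa> (r u)) * (w u)\<^sup>2 - r u * k'"
    using r[OF u] w[OF u] by (simp add: field_simps power2_eq_square)
  \<comment> \<open>As \<open>\<kappa> r^2 / 2 - B = B - 2\<close>, the terms with
    \<open>k^2\<close> and \<open>w^2\<close> share the coefficient \<open>2 - B\<close> and add up
    to it.\<close>
  also have "\<dots> = 2 - bcv_radial \<kappa> (r u) - P' * bcv_radial \<kappa> (r u)"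
    using kw[OF u] four[of u] unfolding rk' by algebra
  finally show ?thesis
    unfolding H sqR[OF u] B[OF u] by (simp add: P'_def mult_ac)
qed

theorem proposition4p2:
  fixes \<kappa> \<tau> m a H :: real
    and I :: "real set"
    and U \<xi>\<^sub>2 \<Theta> :: "real \<Rightarrow> real"
    and \<Psi> :: "real \<Rightarrow> real \<Rightarrow> real^3"
    and \<Delta> B :: "real \<Rightarrow> real"
  assumes I: "open I" "is_interval I"
    and m: "m \<noteq> 0"
    and U_pos: "\<And>u. u \<in> I \<Longrightarrow> U u > 0"
    and U_diff: "\<And>u. u \<in> I \<Longrightarrow> U differentiable (at u)"
    and U_diff2: "\<And>u. u \<in> I \<Longrightarrow> deriv U differentiable (at u)"
    and \<Delta>_def: "\<Delta> = hel_Delta \<kappa> \<tau> U m a"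
    and B_def: "B = hel_B \<kappa> \<tau> U m a"
    and \<Delta>_pos: "\<And>u. u \<in> I \<Longrightarrow> \<Delta> u > 0"
    and xi1_pos: "\<And>u. u \<in> I \<Longrightarrow> hel_xi1 \<kappa> \<tau> U m a u > 0"
    and radicand_pos: "\<And>u. u \<in> I \<Longrightarrow> hel_radicand \<kappa> \<tau> U m a u > 0"
    and xi2: "primitive_on I (hel_xi2_integrand \<kappa> \<tau> U m a) \<xi>\<^sub>2"
    and theta: "primitive_on I (hel_theta_integrand \<kappa> \<tau> U m a) \<Theta>"
    and \<Psi>_def: "\<Psi> = helicoidal_surface \<kappa> \<tau> U m a \<xi>\<^sub>2 \<Theta>"
    and \<Psi>_in: "\<And>u t. u \<in> I \<Longrightarrow> \<Psi> u t \<in> bcv_space \<kappa>"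
  shows "(\<forall>u\<in>I. \<forall>t. mean_curvature (bcv_metric \<kappa> \<tau>) \<Psi> u t = H) \<longleftrightarrow>
    (\<forall>u\<in>I. H * sqrt (4 * (m\<^sup>2 * (U u)\<^sup>2 - a\<^sup>2) / ((1 + sqrt (\<Delta> u))\<^sup>2 - 4 * \<tau>\<^sup>2 * m\<^sup>2 * (U u)\<^sup>2)
                     - m^4 * (B u)\<^sup>2 * (U u)\<^sup>2 * (deriv U u)\<^sup>2 / \<Delta> u)
       = 2 - B u - m\<^sup>2 * B u * deriv (\<lambda>v. U v * deriv U v / sqrt (\<Delta> v)) u)"
proof -
  have D: "(f has_real_derivative deriv f u) (at u)" if "f differentiable (at u)" for f :: "real \<Rightarrow> real" and u
    using that by (metis DERIV_imp_deriv real_differentiable_def)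
  have rad: "4 * (m\<^sup>2 * (U u)\<^sup>2 - a\<^sup>2) / ((1 + sqrt (\<Delta> u))\<^sup>2 - 4 * \<tau>\<^sup>2 * m\<^sup>2 * (U u)\<^sup>2)
      - m^4 * (B u)\<^sup>2 * (U u)\<^sup>2 * (deriv U u)\<^sup>2 / \<Delta> u = hel_radicand \<kappa> \<tau> U m a u" if u: "u \<in> I" for u
    using hel_xi1_pos_imp(2)[OF xi1_pos[OF u]] \<Delta>_pos[OF u]
    unfolding hel_radicand_eq[OF \<Delta>_pos[OF u, unfolded \<Delta>_def] xi1_pos[OF u]]
    by (simp add: \<Delta>_def B_def hel_denom_def power_mult_distrib power_divide mult_ac flip: power_mult)
  \<comment> \<open>The surface lying in the BCV space is exactly
    \<open>1 + \<kappa> r^2 / 4 > 0\<close>; any \<open>t\<close> serves.\<close>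
  have B_pos: "hel_B \<kappa> \<tau> U m a u > 0" if u: "u \<in> I" for u
    using \<Psi>_in[OF u, of 0] hel_B_eq_bcv_radial[OF \<Delta>_pos[OF u, unfolded \<Delta>_def] xi1_pos[OF u]]
    by (simp add: \<Psi>_def bcv_space_def helicoidal_surface_def Let_def)
  have mc: "mean_curvature (bcv_metric \<kappa> \<tau>) \<Psi> u t * sqrt (hel_radicand \<kappa> \<tau> U m a u)
      = 2 - B u - m\<^sup>2 * B u * deriv (\<lambda>v. U v * deriv U v / sqrt (\<Delta> v)) u" if u: "u \<in> I" for u t
    unfolding \<Psi>_def B_def \<Delta>_def
    by (rule mean_curvature_hel[OF I(1) u m U_pos D[OF U_diff] D[OF U_diff2[OF u]]
          \<Delta>_pos[unfolded \<Delta>_def] xi1_pos radicand_pos xi2 theta B_pos])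
  show ?thesis
  \<comment> \<open>The equivalence holds at each \<open>u\<close> separately: the right side of
    \<open>mc\<close> is independent of \<open>t\<close>, and the root multiplying the mean
    curvature is nonzero.\<close>
  proof (intro ball_cong refl)
    fix u
    assume u: "u \<in> I"
    have "sqrt (hel_radicand \<kappa> \<tau> U m a u) \<noteq> 0"
      using radicand_pos[OF u] by simp
    then have "mean_curvature (bcv_metric \<kappa> \<tau>) \<Psi> u t = H \<longleftrightarrow> H * sqrt (hel_radicand \<kappa> \<tau> U m a u)
        = 2 - B u - m\<^sup>2 * B u * deriv (\<lambda>v. U v * deriv U v / sqrt (\<Delta> v)) u" for t
      unfolding mc[OF u, of t, symmetric] by auto
    then show "(\<forall>t. mean_curvature (bcv_metric \<kappa> \<tau>) \<Psi> u t = H) \<longleftrightarrow>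
      H * sqrt (4 * (m\<^sup>2 * (U u)\<^sup>2 - a\<^sup>2) / ((1 + sqrt (\<Delta> u))\<^sup>2 - 4 * \<tau>\<^sup>2 * m\<^sup>2 * (U u)\<^sup>2)
                - m^4 * (B u)\<^sup>2 * (U u)\<^sup>2 * (deriv U u)\<^sup>2 / \<Delta> u)
       = 2 - B u - m\<^sup>2 * B u * deriv (\<lambda>v. U v * deriv U v / sqrt (\<Delta> v)) u"
      unfolding rad[OF u] by blast
  qed
qed

end
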